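(* Let $\mathbf{x},\mathbf{y}\in\{0,1\}^n$ be two distinct strings. Suppose the polynomial $f(z)=Q_{\mathbf{x}}(z)-Q_{\mathbf{y}}(z)$ has $k$ roots at $z=1$ (that is, $1$ is a root of $f$ of multiplicity $k$). Then for any deletion probability $p\in(0,1)$, with $q=1-p$, $$\|\mathbf{E}(\mathbf{x})-\mathbf{E}(\mathbf{y})\|_{\ell_1}\ \ge\ \frac{q}{e}\left(\frac{q}{n}\right)^k .$$
   Context: Strings are indexed from $0$: $\mathbf{x}=x_0x_1\cdots x_{n-1}$, and $Q_{\mathbf{x}}(w)=\sum_{j=0}^{n-1}x_jw^j$. A trace $\tilde{\mathbf{x}}$ of $\mathbf{x}$ is the random subsequence obtained by deleting each bit of $\mathbf{x}$ independently with probability $p$, padded by $\tilde x_j=0$ for $j\ge|\tilde{\mathbf{x}}|$. The mean trace is $\mathbf{E}(\mathbf{x})=(E_0(\mathbf{x}),\dots,E_{n-1}(\mathbf{x}))$ with $E_j(\mathbf{x})=\mathbb{E}[\tilde x_j]=\sum_{k=0}^{n-1}\binom{k}{j}p^{k-j}q^{j+1}x_k$ (where $\binom{k}{j}=0$ for $j>k$). The symbol $e$ is the base of the natural logarithm. *)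

theory Defs
  imports "HOL-Probability.Probability" "HOL-Computational_Algebra.Computational_Algebra"
begin

definition string_poly :: "bool list \<Rightarrow> real poly" where
  "string_poly xs = (\<Sum>j<length xs. monom (of_bool (xs ! j)) j)"

(* The i-th flip d i says whether position i is deleted. *)
definition trace_pmf :: "real \<Rightarrow> bool list \<Rightarrow> bool list pmf" where
  "trace_pmf p xs =
     map_pmf (\<lambda>d. nths xs {i. \<not> d i})
       (Pi_pmf {..<length xs} False (\<lambda>_. bernoulli_pmf p))"

definition padded_bit :: "bool list \<Rightarrow> nat \<Rightarrow> real" where
  "padded_bit t j = (if j < length t then of_bool (t ! j) else 0)"

definition mean_trace :: "real \<Rightarrow> bool list \<Rightarrow> nat \<Rightarrow> real" where
  "mean_trace p xs j = measure_pmf.expectation (trace_pmf p xs) (\<lambda>t. padded_bit t j)"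

lemma trace_pmf_snoc:
  "trace_pmf p (xs @ [b]) =
     bind_pmf (trace_pmf p xs)
       (\<lambda>t. map_pmf (\<lambda>d. if d then t else t @ [b]) (bernoulli_pmf p))"
proof -
  let ?n = "length xs"
  let ?P = "\<lambda>n. Pi_pmf {..<n} False (\<lambda>_::nat. bernoulli_pmf p)"
  have nths_snoc: "nths (xs @ [b]) {i. \<not> (f(?n := d)) i} =
      (if d then nths xs {i. \<not> f i} else nths xs {i. \<not> f i} @ [b])" for f :: "nat \<Rightarrow> bool" and d
  proof -
    have "nths xs {i. \<not> (f(?n := d)) i} = nths xs {i. \<not> f i}"
      unfolding nths_def
      by (intro arg_cong[where f = "map fst"] filter_cong) (auto dest: set_zip_rightD)
    then show ?thesis by (auto simp: nths_append)
  qed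
  have "trace_pmf p (xs @ [b]) =
      map_pmf (\<lambda>(d, f). nths (xs @ [b]) {i. \<not> (f(?n := d)) i}) (pair_pmf (bernoulli_pmf p) (?P ?n))"
    unfolding trace_pmf_def
    by (simp add: lessThan_Suc Pi_pmf_insert pmf.map_comp o_def case_prod_unfold)
  also have "\<dots> = map_pmf (\<lambda>(d, f). if d then nths xs {i. \<not> f i} else nths xs {i. \<not> f i} @ [b])
      (pair_pmf (bernoulli_pmf p) (?P ?n))"
    by (simp only: nths_snoc)
  also have "\<dots> = bind_pmf (trace_pmf p xs)
       (\<lambda>t. map_pmf (\<lambda>d. if d then t else t @ [b]) (bernoulli_pmf p))"
    unfolding trace_pmf_def pair_pmf_def map_pmf_def
    by (subst bind_commute_pmf) (simp add: bind_assoc_pmf bind_return_pmf case_prod_unfold snd_conv cong: if_cong)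
  finally show ?thesis .
qed

lemma finite_set_trace_pmf: "finite (set_pmf (trace_pmf p xs))"
proof (induction xs rule: rev_induct)
  case Nil
  then show ?case by (simp add: trace_pmf_def)
next
  case (snoc b xs)
  then show ?case by (auto simp: trace_pmf_snoc set_bind_pmf)
qed

lemma expectation_trace_pmf_snoc:
  fixes h :: "bool list \<Rightarrow> real"
  assumes "0 \<le> p" "p \<le> 1"
  shows "measure_pmf.expectation (trace_pmf p (xs @ [b])) h =
    p * measure_pmf.expectation (trace_pmf p xs) h +
    (1 - p) * measure_pmf.expectation (trace_pmf p xs) (\<lambda>t. h (t @ [b]))"
proof -
  have fin: "finite (set_pmf (trace_pmf p xs))" by (rule finite_set_trace_pmf)
  show ?thesis
    unfolding trace_pmf_snoc
    by (subst pmf_expectation_bind[OF fin])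
       (use assms fin in \<open>auto simp: integral_measure_pmf_real[OF fin] sum_distrib_left
          sum.distrib[symmetric] algebra_simps intro!: sum.cong\<close>)
qed

lemma prob_length_trace_pmf:
  assumes "0 \<le> p" "p \<le> 1"
  shows "measure_pmf.expectation (trace_pmf p xs) (\<lambda>t. of_bool (length t = j)) =
    real (length xs choose j) * p ^ (length xs - j) * (1 - p) ^ j"
proof (induction xs arbitrary: j rule: rev_induct)
  case Nil
  then show ?case by (simp add: trace_pmf_def)
next
  case (snoc b xs)
  show ?case
  proof (cases j)
    case 0
    then show ?thesis using snoc[of 0] by (simp add: expectation_trace_pmf_snoc[OF assms])
  next
    case (Suc i)
    have "p * p ^ (length xs - Suc i) = p ^ (length xs - i)" if "i < length xs"
      using that by (metis Suc_diff_Suc power_Suc)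
    then have step: "real (length xs choose Suc i) * (p * p ^ (length xs - Suc i)) =
        real (length xs choose Suc i) * p ^ (length xs - i)"
      by (cases "i < length xs") auto
    have "p * (real (length xs choose Suc i) * p ^ (length xs - Suc i) * (1 - p) ^ Suc i) =
        real (length xs choose Suc i) * (p * p ^ (length xs - Suc i)) * (1 - p) ^ Suc i"
      by (simp only: mult_ac)
    then have "p * (real (length xs choose Suc i) * p ^ (length xs - Suc i) * (1 - p) ^ Suc i) +
          (1 - p) * (real (length xs choose i) * p ^ (length xs - i) * (1 - p) ^ i) =
        real (length (xs @ [b]) choose Suc i) * p ^ (length (xs @ [b]) - Suc i) * (1 - p) ^ Suc i"
      unfolding step by (simp add: distrib_right distrib_left mult_ac)
    then show ?thesis
      unfolding Suc expectation_trace_pmf_snoc[OF assms] snoc[of "Suc i"]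
      using snoc[of i] by simp
  qed
qed

lemma mean_trace_eq:
  assumes "0 \<le> p" "p \<le> 1"
  shows "mean_trace p xs j =
    (\<Sum>k<length xs. real (k choose j) * p ^ (k - j) * (1 - p) ^ (j + 1) * of_bool (xs ! k))"
proof (induction xs rule: rev_induct)
  case Nil
  then show ?case by (simp add: mean_trace_def trace_pmf_def padded_bit_def)
next
  case (snoc b xs)
  have fin: "finite (set_pmf (trace_pmf p xs))" by (rule finite_set_trace_pmf)
  have bit: "padded_bit (t @ [b]) j = padded_bit t j + of_bool b * of_bool (length t = j)" for t
    by (auto simp: padded_bit_def nth_append)
  have "measure_pmf.expectation (trace_pmf p xs) (\<lambda>t. padded_bit (t @ [b]) j) =
      mean_trace p xs j +
      of_bool b * (real (length xs choose j) * p ^ (length xs - j) * (1 - p) ^ j)"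
    unfolding bit mean_trace_def prob_length_trace_pmf[OF assms, symmetric]
    by (subst Bochner_Integration.integral_add)
       (auto intro: integrable_measure_pmf_finite fin)
  then have "mean_trace p (xs @ [b]) j = mean_trace p xs j +
      (1 - p) * (of_bool b * (real (length xs choose j) * p ^ (length xs - j) * (1 - p) ^ j))"
    unfolding mean_trace_def expectation_trace_pmf_snoc[OF assms]
    by (simp add: algebra_simps)
  then show ?case
    using snoc by (simp add: nth_append)
qed

end

(* With f = Q_x - Q_y, the differences of the mean traces are q times the coefficients of
   f(p + q w). Expanding this polynomial at w = 1, where p + q w = 1, its k-th Taylor
   coefficient is q^k times the k-th Taylor coefficient of f at 1, a nonzero integer. On the
   other hand it is the sum of the coefficients weighted by (j choose k) <= n^k. This gives
   the bound even without the factor 1/e. *)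
theory Submission
  imports Defs
begin

lemma pcompose_power:
  fixes f g :: "'a::comm_ring_1 poly"
  shows "(f ^ m) \<circ>\<^sub>p g = (f \<circ>\<^sub>p g) ^ m"
  by (induction m) (simp_all add: pcompose_mult pcompose_1)

text \<open>Substitution is linear in \<open>f\<close>, so each power of \<open>[:a, b:]\<close> can
  be expanded by the binomial theorem. With a free bound \<open>n\<close> instead of the degree, the
  sum can run over the positions of a string.\<close>

lemma coeff_pcompose_linear_poly:
  fixes f :: "'a::comm_ring_1 poly"
  assumes "\<And>m. m \<ge> n \<Longrightarrow> coeff f m = 0"
  shows "coeff (f \<circ>\<^sub>p [:a, b:]) k =
    (\<Sum>m<n. coeff f m * (of_nat (m choose k) * b ^ k * a ^ (m - k)))"
proof -
  have "f = (\<Sum>m<n. monom (coeff f m) m)"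
    by (rule poly_eqI) (use assms in \<open>auto simp: coeff_sum not_less\<close>)
  also have "\<dots> = (\<Sum>m<n. smult (coeff f m) ([:0, 1:] ^ m))"
    by (simp add: monom_altdef)
  finally have "f \<circ>\<^sub>p [:a, b:] = (\<Sum>m<n. smult (coeff f m) ([:0, 1:] ^ m)) \<circ>\<^sub>p [:a, b:]"
    by (rule arg_cong)
  also have "\<dots> = (\<Sum>m<n. smult (coeff f m) ([:a, b:] ^ m))"
    by (simp add: pcompose_sum pcompose_smult pcompose_power pcompose_pCons)
  finally have "coeff (f \<circ>\<^sub>p [:a, b:]) k = (\<Sum>m<n. coeff f m * coeff ([:a, b:] ^ m) k)"
    by (simp add: coeff_sum)
  moreover have "coeff ([:a, b:] ^ m) k = of_nat (m choose k) * b ^ k * a ^ (m - k)" for m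
  proof (cases "k \<le> m")
    \<comment> \<open>Above the degree both sides are 0: the binomial coefficient vanishes, whatever
      the truncated exponent \<open>m - k\<close> is.\<close>
    case False
    have "degree ([:a, b:] ^ m) \<le> 1 * m"
      by (rule order_trans[OF degree_power_le]) simp
    with False show ?thesis by (simp add: coeff_eq_0 binomial_eq_0)
  qed (rule coeff_linear_poly_power)
  ultimately show ?thesis by simp
qed

text \<open>The shift by \<open>a\<close> turns the factor (X - a)^m, where m is the order, into
  X^m. The coefficient is thus the value at \<open>a\<close> of the cofactor, which X - a does not
  divide.\<close>

lemma coeff_pcompose_order_nonzero:
  fixes f :: "'a::idom poly"
  assumes "f \<noteq> 0"
  shows "coeff (f \<circ>\<^sub>p [:a, 1:]) (order a f) \<noteq> 0"
proof -
  obtain h where h: "f = [:-a, 1:] ^ order a f * h" "\<not> [:-a, 1:] dvd h"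
    using order_decomp[OF assms] by blast
  have "f \<circ>\<^sub>p [:a, 1:] = [:0, 1:] ^ order a f * (h \<circ>\<^sub>p [:a, 1:])"
    by (subst h(1)) (simp add: pcompose_mult pcompose_power pcompose_pCons)
  then have "coeff (f \<circ>\<^sub>p [:a, 1:]) (order a f) = coeff (h \<circ>\<^sub>p [:a, 1:]) 0"
    by (simp flip: monom_altdef[of 1, simplified] add: coeff_monom_mult)
  also have "\<dots> = poly h a"
    by (simp flip: poly_0_coeff_0 add: poly_pcompose)
  finally show ?thesis
    using h(2) by (simp add: poly_eq_0_iff_dvd)
qed

lemma coeff_string_poly:
  "coeff (string_poly xs) m = (if m < length xs then of_bool (xs ! m) else 0)"
  by (auto simp: string_poly_def coeff_sum)

text \<open>Trailing zeros leave no mark on the polynomial, hence the assumption of equal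
  lengths.\<close>

lemma string_poly_eq_imp_eq:
  assumes "length x = length y" and "string_poly x = string_poly y"
  shows "x = y"
proof (rule nth_equalityI)
  fix i assume "i < length x"
  then show "x ! i = y ! i"
    using arg_cong[OF assms(2), of "\<lambda>f. coeff f i"] assms(1)
    by (simp add: coeff_string_poly of_bool_eq_iff)
qed (rule assms(1))

text \<open>The closed form of the mean trace is a binomial expansion with exponent
  \<open>j + 1\<close> on \<open>1 - p\<close> in place of \<open>j\<close>; the surplus factor
  stands in front.\<close>

lemma mean_trace_eq_coeff:
  assumes "0 \<le> p" "p \<le> 1"
  shows "mean_trace p xs j = (1 - p) * coeff (string_poly xs \<circ>\<^sub>p [:p, 1 - p:]) j"
  unfolding mean_trace_eq[OF assms]
  by (subst coeff_pcompose_linear_poly[of "length xs"])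
     (auto simp: coeff_string_poly sum_distrib_left intro!: sum.cong)

theorem theorem7:
  fixes x y :: "bool list" and n k :: nat and p q :: real
  assumes "length x = n" and "length y = n" and "x \<noteq> y"
    and "order 1 (string_poly x - string_poly y) = k"
    and "0 < p" and "p < 1" and "q = 1 - p"
  shows "(\<Sum>j<n. \<bar>mean_trace p x j - mean_trace p y j\<bar>) \<ge> q / exp 1 * (q / real n) ^ k"
proof -
  define f where "f = string_poly x - string_poly y"
  define d where "d j = mean_trace p x j - mean_trace p y j" for j
  define c where "c = coeff (f \<circ>\<^sub>p [:1, 1:]) k"
  have q: "0 < q" using assms by simp
  have n: "n > 0" using assms(1-3) by (cases n) auto
  have f0: "f \<noteq> 0" using string_poly_eq_imp_eq assms(1-3) by (auto simp: f_def)
  have coeff_f: "coeff f m = 0" if "m \<ge> n" for m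
    using that assms(1,2) by (simp add: f_def coeff_string_poly)
  have expand: "coeff (f \<circ>\<^sub>p [:a, b:]) i =
      (\<Sum>m<n. coeff f m * (real (m choose i) * b ^ i * a ^ (m - i)))" for a b i
    by (rule coeff_pcompose_linear_poly) (rule coeff_f)
  have d: "d j = q * coeff (f \<circ>\<^sub>p [:p, q:]) j" for j
    using assms(5-7) by (simp add: d_def f_def mean_trace_eq_coeff pcompose_diff right_diff_distrib)
  \<comment> \<open>At a = b = 1 the expansion has only binomial coefficients, weighted by
    differences of bits.\<close>
  have "c \<in> \<int>"
    unfolding c_def expand
    by (intro Ints_sum) (auto simp: f_def coeff_string_poly)
  moreover have "c \<noteq> 0"
    using coeff_pcompose_order_nonzero[OF f0, of 1] assms(4) by (simp add: c_def f_def)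
  ultimately have c: "1 \<le> \<bar>c\<bar>" by (rule Ints_nonzero_abs_ge1)
  \<comment> \<open>This is the expansion at a = b = 1 again. The bound \<open>n\<close> survives
    the first substitution: for j \<ge> n, every \<open>m choose j\<close> with m < n is 0.\<close>
  have "(\<Sum>j<n. coeff (f \<circ>\<^sub>p [:p, q:]) j * real (j choose k)) =
      coeff ((f \<circ>\<^sub>p [:p, q:]) \<circ>\<^sub>p [:1, 1:]) k"
    by (subst coeff_pcompose_linear_poly[of n "f \<circ>\<^sub>p [:p, q:]"])
       (auto simp: expand intro!: sum.neutral)
  \<comment> \<open>p + q (1 + X) = 1 + q X, since p + q = 1.\<close>
  also have "(f \<circ>\<^sub>p [:p, q:]) \<circ>\<^sub>p [:1, 1:] = f \<circ>\<^sub>p [:1, q:]"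
    using assms(7) by (simp add: pcompose_pCons flip: pcompose_assoc)
  also have "coeff (f \<circ>\<^sub>p [:1, q:]) k = q ^ k * c"
    by (simp add: c_def expand sum_distrib_left mult_ac)
  finally have taylor: "(\<Sum>j<n. d j * real (j choose k)) = q * (q ^ k * c)"
    by (simp add: d mult.assoc flip: sum_distrib_left)
  \<comment> \<open>This bound on the weights is the source of the denominator n^k.\<close>
  have choose: "real (j choose k) \<le> real n ^ k" if "j < n" for j
  proof (cases "k \<le> j")
    case True
    then have "j choose k \<le> j ^ k" by (rule binomial_le_pow)
    also have "\<dots> \<le> n ^ k" using that by (intro power_mono) auto
    finally show ?thesis by (metis of_nat_le_iff of_nat_power)
  qed (simp add: binomial_eq_0)
  have "q * q ^ k * 1 \<le> q * q ^ k * \<bar>c\<bar>"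
    using q c by (intro mult_left_mono) auto
  also have "\<dots> = \<bar>\<Sum>j<n. d j * real (j choose k)\<bar>"
    using q by (simp add: taylor abs_mult)
  also have "\<dots> \<le> (\<Sum>j<n. \<bar>d j\<bar> * real (j choose k))"
    by (rule order_trans[OF sum_abs]) (simp add: abs_mult)
  also have "\<dots> \<le> (\<Sum>j<n. \<bar>d j\<bar> * real n ^ k)"
    by (intro sum_mono mult_left_mono choose) simp_all
  finally have "q * (q / real n) ^ k \<le> (\<Sum>j<n. \<bar>d j\<bar>)"
    using n by (simp add: power_divide divide_le_eq flip: sum_distrib_right)
  moreover have "q / exp 1 \<le> q"
    using q by (simp add: divide_le_eq)
  then have "q / exp 1 * (q / real n) ^ k \<le> q * (q / real n) ^ k"
    using q by (intro mult_right_mono) auto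
  ultimately show ?thesis by (simp add: d_def)
qed

end
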